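(* Let $\mathsf{L}^\star$ be any of the logics described in the context and $\mathsf{CS}$ any constant specification for it. For every formula $F\in\mathcal{L}_J$: if $\mathsf{L}^\star_{\mathsf{CS}}\vdash F$, then $\mathcal{M},\omega\Vdash F$ for every $\mathsf{L}^\star_{\mathsf{CS}}$-subset model $\mathcal{M}=(W,W_0,V,E)$ and every $\omega\in W_0$.
   Context: Terms $\mathsf{Tm}$ are built from countably many constants $c_i$, countably many variables $x_i$ and one special constant $\mathsf{c}^\star$ by $t::=c_i\mid x_i\mid \mathsf{c}^\star\mid (t+t)\mid\ !t$. Formulas $\mathcal{L}_J$ are built from countably many atomic propositions $p_i$ by $F::=p_i\mid\bot\mid F\to F\mid t:F$ (other connectives are abbreviations). The $\mathsf{c}^\star$-terms are defined inductively: $\mathsf{c}^\star$ is a $\mathsf{c}^\star$-term, and if $c$ is a $\mathsf{c}^\star$-term and $s,t$ are any terms then $s+c$ and $c+t$ are $\mathsf{c}^\star$-terms. Axiom schemes: (cl) all axioms of classical propositional logic; (j+) $s:A\lor t:A\to(s+t):A$; (jc$^\star$) $c:A\land c:(A\to B)\to c:B$ for every $\mathsf{c}^\star$-term $c$; (j4) $t:A\to\ !t:(t:A)$; (jd) $t:\bot\to\bot$; (jt) $t:A\to A$. A logic $\mathsf{L}^\star$ consists of (cl), (j+), (jc$^\star$) together with some subset of $\{$(j4),(jd),(jt)$\}$. A constant specification $\mathsf{CS}$ is a set of pairs $(c,A)$ with $c$ a constant and $A$ an axiom of $\mathsf{L}^\star$. The Hilbert system $\mathsf{L}^\star_{\mathsf{CS}}$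 has the axioms of $\mathsf{L}^\star$ and the rules modus ponens and axiom necessitation: for every $(c,A)\in\mathsf{CS}$ and every $n\ge 0$ infer $!^nc:\,!^{n-1}c:\cdots:\,!c:c:A$, where $!^kc$ denotes $c$ preceded by $k$ occurrences of $!$. An $\mathsf{L}^\star_{\mathsf{CS}}$-subset model is $\mathcal{M}=(W,W_0,V,E)$ where $W$ is a set, $\emptyset\neq W_0\subseteq W$, $V:W\times\mathcal{L}_J\to\{0,1\}$, $E:W\times\mathsf{Tm}\to\mathcal{P}(W)$, such that, writing $[A]=\{\upsilon\in W: V(\upsilon,A)=1\}$ and $W_{MP}=\{\upsilon\in W:$ for all $A,B\in\mathcal{L}_J$, $V(\upsilon,A)=1$ and $V(\upsilon,A\to B)=1$ imply $V(\upsilon,B)=1\}$, for all $\omega\in W_0$, all $s,t\in\mathsf{Tm}$ and all $F,G\in\mathcal{L}_J$: $V(\omega,\bot)=0$; $V(\omega,F\to G)=1$ iff $V(\omega,F)=0$ or $V(\omega,G)=1$; $V(\omega,t:F)=1$ iff $E(\omega,t)\subseteq[F]$; $E(\omega,s+t)\subseteq E(\omega,s)\cap E(\omega,t)$; $E(\omega,\mathsf{c}^\star)\subseteq W_{MP}$; if (jd) is in $\mathsf{L}^\star$ then some $\upsilon\in W_0$ lies in $E(\omega,t)$; if (jt) is in $\mathsf{L}^\star$ then $\omega\in E(\omega,t)$; if (j4) is in $\mathsf{L}^\star$ then $E(\omega,!t)\subseteq\{\upsilon\in W:$ for all $F$, $V(\omega,t:F)=1$ implies $V(\upsilon,t:F)=1\}$;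 for all $(c,A)\in\mathsf{CS}$ and all $n\ge1$: $E(\omega,c)\subseteq[A]$ and $E(\omega,!^nc)\subseteq[!^{n-1}c:\cdots:\,!c:c:A]$. No conditions are imposed at worlds in $W\setminus W_0$. Truth: $\mathcal{M},\omega\Vdash F$ iff $V(\omega,F)=1$. *)

theory Defs
  imports Main
begin

datatype tm =
    Const nat
  | Var nat
  | CStar
  | Plus tm tm  (infixl "\<^bold>+" 75)
  | Bang tm  ("\<^bold>!_" [90] 90)

datatype fm =
    Atom nat
  | Bot  ("\<^bold>\<bottom>")
  | Imp fm fm  (infixr "\<^bold>\<rightarrow>" 55)
  | Just tm fm  (infixr "\<^bold>:" 70)

abbreviation Neg :: "fm \<Rightarrow> fm"  ("\<^bold>\<not>_" [65] 65) where
  "\<^bold>\<not>A \<equiv> A \<^bold>\<rightarrow> \<^bold>\<bottom>"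

abbreviation Or :: "fm \<Rightarrow> fm \<Rightarrow> fm"  (infixr "\<^bold>\<or>" 58) where
  "A \<^bold>\<or> B \<equiv> \<^bold>\<not>A \<^bold>\<rightarrow> B"

abbreviation And :: "fm \<Rightarrow> fm \<Rightarrow> fm"  (infixr "\<^bold>\<and>" 60) where
  "A \<^bold>\<and> B \<equiv> \<^bold>\<not>(A \<^bold>\<rightarrow> \<^bold>\<not>B)"

inductive cstar_term :: "tm \<Rightarrow> bool" where
  "cstar_term CStar"
| "cstar_term c \<Longrightarrow> cstar_term (s \<^bold>+ c)"
| "cstar_term c \<Longrightarrow> cstar_term (c \<^bold>+ t)"

(* Boolean evaluation in which the atomic propositions and the formulas t : F
   are the propositional letters, their values being given by v. *)
primrec bool_eval :: "(fm \<Rightarrow> bool) \<Rightarrow> fm \<Rightarrow> bool" where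
  "bool_eval v (Atom i) = v (Atom i)"
| "bool_eval v \<^bold>\<bottom> = False"
| "bool_eval v (F \<^bold>\<rightarrow> G) = (bool_eval v F \<longrightarrow> bool_eval v G)"
| "bool_eval v (t \<^bold>: F) = v (t \<^bold>: F)"

definition tautology :: "fm \<Rightarrow> bool" where
  "tautology F \<longleftrightarrow> (\<forall>v. bool_eval v F)"

(* A logic is given by the set of those schemes j4, jd, jt that it contains. *)
datatype scheme = J4 | JD | JT

(* The axioms (cl) are all propositional tautologies of the language. Every particular
   choice of classical axioms is included in this one, and so are the constant
   specifications and the derivations based on it. *)
inductive axiom :: "scheme set \<Rightarrow> fm \<Rightarrow> bool" for L :: "scheme set" where
  cl: "tautology F \<Longrightarrow> axiom L F"
| jplus: "axiom L (s \<^bold>: A \<^bold>\<or> t \<^bold>: A \<^bold>\<rightarrow> (s \<^bold>+ t) \<^bold>: A)"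
| jcstar: "cstar_term c \<Longrightarrow> axiom L (c \<^bold>: A \<^bold>\<and> c \<^bold>: (A \<^bold>\<rightarrow> B) \<^bold>\<rightarrow> c \<^bold>: B)"
| j4: "J4 \<in> L \<Longrightarrow> axiom L (t \<^bold>: A \<^bold>\<rightarrow> \<^bold>!t \<^bold>: t \<^bold>: A)"
| jd: "JD \<in> L \<Longrightarrow> axiom L (t \<^bold>: \<^bold>\<bottom> \<^bold>\<rightarrow> \<^bold>\<bottom>)"
| jt: "JT \<in> L \<Longrightarrow> axiom L (t \<^bold>: A \<^bold>\<rightarrow> A)"

(* The special constant counts as a constant, so a constant specification may mention it
   but need not. *)
inductive is_constant :: "tm \<Rightarrow> bool" where
  "is_constant (Const i)"
| "is_constant CStar"

definition constant_specification :: "scheme set \<Rightarrow> (tm \<times> fm) set \<Rightarrow> bool" where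
  "constant_specification L CS \<longleftrightarrow> (\<forall>(c, A) \<in> CS. is_constant c \<and> axiom L A)"

(* bang_chain n c A is  !^n c : !^(n-1) c : ... : !c : c : A *)
primrec bang_chain :: "nat \<Rightarrow> tm \<Rightarrow> fm \<Rightarrow> fm" where
  "bang_chain 0 c A = c \<^bold>: A"
| "bang_chain (Suc n) c A = (Bang ^^ Suc n) c \<^bold>: bang_chain n c A"

inductive derivable :: "scheme set \<Rightarrow> (tm \<times> fm) set \<Rightarrow> fm \<Rightarrow> bool"
  for L :: "scheme set" and CS :: "(tm \<times> fm) set" where
  ax: "axiom L F \<Longrightarrow> derivable L CS F"
| mp: "derivable L CS F \<Longrightarrow> derivable L CS (F \<^bold>\<rightarrow> G) \<Longrightarrow> derivable L CS G"
| nec: "(c, A) \<in> CS \<Longrightarrow> derivable L CS (bang_chain n c A)"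

record 'w model =
  W :: "'w set"
  W0 :: "'w set"
  V :: "'w \<Rightarrow> fm \<Rightarrow> bool"
  E :: "'w \<Rightarrow> tm \<Rightarrow> 'w set"

definition ext :: "'w model \<Rightarrow> fm \<Rightarrow> 'w set" where
  "ext M A = {v \<in> W M. V M v A}"

definition WMP :: "'w model \<Rightarrow> 'w set" where
  "WMP M = {v \<in> W M. \<forall>A B. V M v A \<and> V M v (A \<^bold>\<rightarrow> B) \<longrightarrow> V M v B}"

definition subset_model :: "scheme set \<Rightarrow> (tm \<times> fm) set \<Rightarrow> 'w model \<Rightarrow> bool" where
  "subset_model L CS M \<longleftrightarrow>
     W0 M \<subseteq> W M \<and> W0 M \<noteq> {} \<and>
     (\<forall>w \<in> W M. \<forall>t. E M w t \<subseteq> W M) \<and>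
     (\<forall>w \<in> W0 M.
        \<not> V M w \<^bold>\<bottom> \<and>
        (\<forall>F G. V M w (F \<^bold>\<rightarrow> G) \<longleftrightarrow> \<not> V M w F \<or> V M w G) \<and>
        (\<forall>t F. V M w (t \<^bold>: F) \<longleftrightarrow> E M w t \<subseteq> ext M F) \<and>
        (\<forall>s t. E M w (s \<^bold>+ t) \<subseteq> E M w s \<inter> E M w t) \<and>
        E M w CStar \<subseteq> WMP M \<and>
        (JD \<in> L \<longrightarrow> (\<forall>t. \<exists>v \<in> W0 M. v \<in> E M w t)) \<and>
        (JT \<in> L \<longrightarrow> (\<forall>t. w \<in> E M w t)) \<and>
        (J4 \<in> L \<longrightarrow> (\<forall>t. E M w (\<^bold>!t) \<subseteq>
           {v \<in> W M. \<forall>F. V M w (t \<^bold>: F) \<longrightarrow> V M v (t \<^bold>: F)})) \<and>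
        (\<forall>(c, A) \<in> CS. E M w c \<subseteq> ext M A \<and>
           (\<forall>n \<ge> 1. E M w ((Bang ^^ n) c) \<subseteq> ext M (bang_chain (n - 1) c A))))"

definition satisfies :: "'w model \<Rightarrow> 'w \<Rightarrow> fm \<Rightarrow> bool" where
  "satisfies M w F \<longleftrightarrow> V M w F"

end

theory Submission
  imports Defs
begin

text \<open>Induction on derivations, with the normal world \<open>w\<close> fixed. At
  \<open>w\<close> the valuation respects falsum and implication, so it is a Boolean valuation whose
  letters are the atoms and the formulas t : F; hence tautologies hold and modus ponens preserves
  truth. Since t : F holds at \<open>w\<close> iff E(w,t) lies in the extension of F, each
  justification axiom reduces to an inclusion or membership supplied by the model's condition on
  \<open>E\<close> (\<open>axiom_sound\<close>). Necessitation is covered by the conditions for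
  \<open>CS\<close> (\<open>bang_chain_sound\<close>).\<close>

lemma subset_model_Bot:
  assumes "subset_model L CS M" "w \<in> W0 M"
  shows "\<not> V M w \<^bold>\<bottom>"
  using assms by (simp add: subset_model_def)

lemma subset_model_Imp:
  assumes "subset_model L CS M" "w \<in> W0 M"
  shows "V M w (F \<^bold>\<rightarrow> G) \<longleftrightarrow> (V M w F \<longrightarrow> V M w G)"
  using assms by (simp add: subset_model_def)

lemma subset_model_Just:
  assumes "subset_model L CS M" "w \<in> W0 M"
  shows "V M w (t \<^bold>: F) \<longleftrightarrow> E M w t \<subseteq> ext M F"
  using assms by (simp add: subset_model_def)

text \<open>Feeding the world's own valuation to \<open>bool_eval\<close> makes the cases of atoms
  and t : F trivial; thus a tautology, true under every valuation, is true at
  \<open>w\<close>.\<close>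

lemma subset_model_bool_eval:
  assumes "subset_model L CS M" "w \<in> W0 M"
  shows "bool_eval (V M w) F \<longleftrightarrow> V M w F"
  by (induction F) (simp_all add: subset_model_Bot[OF assms] subset_model_Imp[OF assms])

text \<open>The model constrains only \<open>CStar\<close> itself; larger terms inherit the
  inclusion because a sum has fewer accessible worlds than either summand.\<close>

lemma subset_model_cstar_term:
  assumes "subset_model L CS M" "w \<in> W0 M" "cstar_term c"
  shows "E M w c \<subseteq> WMP M"
  using assms(3,1,2)
proof (induction rule: cstar_term.induct)
  case 1
  then show ?case by (simp add: subset_model_def)
next
  case (2 c s)
  then have "E M w (s \<^bold>+ c) \<subseteq> E M w c"
    by (simp add: subset_model_def)
  with 2 show ?case by blast
next
  case (3 c t)
  then have "E M w (c \<^bold>+ t) \<subseteq> E M w c"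
    by (simp add: subset_model_def)
  with 3 show ?case by blast
qed

lemma axiom_sound:
  assumes "axiom L F" and M: "subset_model L CS M" and w: "w \<in> W0 M"
  shows "V M w F"
proof -
  note bot = subset_model_Bot[OF M w] and imp = subset_model_Imp[OF M w]
    and just = subset_model_Just[OF M w]
  from assms(1) show ?thesis
  proof cases
    case cl
    then show ?thesis
      using subset_model_bool_eval[OF M w] by (auto simp: tautology_def)
  next
    case (jplus s A t)
    have "E M w (s \<^bold>+ t) \<subseteq> E M w s \<inter> E M w t"
      using M w by (simp add: subset_model_def)
    then show ?thesis
      unfolding jplus imp just using bot by blast
  next
    case (jcstar c A B)
    \<comment> \<open>Worlds in E(w,c) may be non-normal, where implication need not be classical;
      membership in \<open>WMP\<close> is what licenses modus ponens there.\<close>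
    have "ext M A \<inter> ext M (A \<^bold>\<rightarrow> B) \<inter> WMP M \<subseteq> ext M B"
      by (auto simp: ext_def WMP_def)
    then show ?thesis
      unfolding jcstar(1) imp just
      using bot subset_model_cstar_term[OF M w jcstar(2)] by blast
  next
    case (j4 t A)
    have "\<forall>w \<in> W0 M. J4 \<in> L \<longrightarrow> (\<forall>t. E M w (\<^bold>!t) \<subseteq>
        {v \<in> W M. \<forall>F. V M w (t \<^bold>: F) \<longrightarrow> V M v (t \<^bold>: F)})"
      using M unfolding subset_model_def ball_conj_distrib by (elim conjE) assumption
    then have "E M w (\<^bold>!t) \<subseteq> {v \<in> W M. \<forall>F. V M w (t \<^bold>: F) \<longrightarrow> V M v (t \<^bold>: F)}"
      using w j4(2) by blast
    then show ?thesis
      \<comment> \<open>Only the outer justification is unfolded, so that the premise t : A keeps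
        the form in which the J4 condition transfers it to the worlds of E(w,!t).\<close>
      unfolding j4(1) imp just[of "\<^bold>!t"] by (auto simp: ext_def)
  next
    case (jd t)
    then have "\<exists>v \<in> W0 M. v \<in> E M w t"
      using M w by (simp add: subset_model_def)
    then obtain v where "v \<in> W0 M" "v \<in> E M w t"
      by blast
    \<comment> \<open>The witness must be normal: elsewhere falsum may be true.\<close>
    moreover from this have "\<not> V M v \<^bold>\<bottom>"
      using subset_model_Bot[OF M] by blast
    ultimately show ?thesis
      unfolding jd(1) imp just by (auto simp: ext_def)
  next
    case (jt t A)
    then have "w \<in> E M w t"
      using M w by (simp add: subset_model_def)
    then show ?thesis
      unfolding jt(1) imp just by (auto simp: ext_def)
  qed
qed

text \<open>No induction on \<open>n\<close> is needed: truth of the chain at \<open>w\<close> is a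
  single inclusion for its outermost term, which the conditions for \<open>CS\<close> give directly
  for each length.\<close>

lemma bang_chain_sound:
  assumes "subset_model L CS M" "w \<in> W0 M" "(c, A) \<in> CS"
  shows "V M w (bang_chain n c A)"
proof -
  note just = subset_model_Just[OF assms(1,2)]
  have cs: "\<forall>(c, A) \<in> CS. E M w c \<subseteq> ext M A \<and>
      (\<forall>n \<ge> 1. E M w ((Bang ^^ n) c) \<subseteq> ext M (bang_chain (n - 1) c A))"
    using assms(1,2) by (simp add: subset_model_def)
  have base: "E M w c \<subseteq> ext M A"
    and step: "\<And>n. n \<ge> 1 \<Longrightarrow> E M w ((Bang ^^ n) c) \<subseteq> ext M (bang_chain (n - 1) c A)"
    using bspec[OF cs assms(3)] by simp_all
  show ?thesis
  proof (cases n)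
    case 0
    then show ?thesis by (simp add: just base)
  next
    case (Suc m)
    then show ?thesis using step[of "Suc m"] by (simp add: just)
  qed
qed

theorem mainTheorem1:
  fixes L :: "scheme set" and CS :: "(tm \<times> fm) set" and F :: fm
    and M :: "'w model" and w :: 'w
  assumes CS: "constant_specification L CS"
    and der: "derivable L CS F"
    and model: "subset_model L CS M"
    and w: "w \<in> W0 M"
  shows "satisfies M w F"
  using der unfolding satisfies_def
proof (induction rule: derivable.induct)
  case (ax F)
  then show ?case using model w by (rule axiom_sound)
next
  case (mp F G)
  then show ?case by (simp add: subset_model_Imp[OF model w])
next
  case (nec c A n)
  with model w show ?case by (rule bang_chain_sound)
qed

end
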